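(* Let $0<q<1$ and let $\nu>-1$ be real with $\nu\notin\{0,1,2,\dots\}$. Let $\lambda\in\mathbb{C}$ and let $f$ and $h$ be two linearly independent solutions (functions on $\mathbb{R}_q^+$) of the $q$-difference equation $$\Delta_{q,\nu}y(x)=\lambda y(x),\qquad x\in\mathbb{R}_q^+ .$$ Then for all integers $n\ge0$ $$P_n(\lambda)=q^{-n(\nu+1)}\left[\frac{f(q^{-n})h(q)-h(q^{-n})f(q)}{f(1)h(q)-h(1)f(q)}\right].$$
   Context: $\mathbb{R}_q^+=\{q^n:n\in\mathbb{Z}\}$. The $q$-Bessel operator is $$\Delta_{q,\nu}f(x)=\frac{1}{x^2}\Big[f(q^{-1}x)-(1+q^{2\nu})f(x)+q^{2\nu}f(qx)\Big].$$ The polynomials $(P_n)$ are defined by $P_{-1}=0$, $P_0=1$ and, for $n\ge0$, $$q^{2n+\nu+1}P_{n+1}(\lambda)-q^{2n}(1+q^{2\nu})P_n(\lambda)+q^{2n+\nu-1}P_{n-1}(\lambda)=\lambda P_n(\lambda).$$ *)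

theory Defs
  imports Complex_Main "HOL-Computational_Algebra.Polynomial"
begin

definition Rq_plus :: "real \<Rightarrow> real set" where
  "Rq_plus q = {q powi n | n :: int. True}"

(* A function on Rq_plus q is represented by a total function on the reals.  For x in Rq_plus q
   the operator only looks at values of f on Rq_plus q. *)
definition q_Bessel :: "real \<Rightarrow> real \<Rightarrow> (real \<Rightarrow> complex) \<Rightarrow> real \<Rightarrow> complex" where
  "q_Bessel q \<nu> f x =
     1 / of_real (x\<^sup>2) *
       (f (inverse q * x) - of_real (1 + q powr (2 * \<nu>)) * f x + of_real (q powr (2 * \<nu>)) * f (q * x))"

definition q_Bessel_solution :: "real \<Rightarrow> real \<Rightarrow> complex \<Rightarrow> (real \<Rightarrow> complex) \<Rightarrow> bool" where
  "q_Bessel_solution q \<nu> lam y \<longleftrightarrow> (\<forall>x\<in>Rq_plus q. q_Bessel q \<nu> y x = lam * y x)"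

(* Linear independence over the complex numbers of the restrictions of f and h to S, as a
   two-element family (so f = h counts as dependent, unlike independence of the set {f, h}). *)
definition lin_indep_on :: "'a set \<Rightarrow> ('a \<Rightarrow> complex) \<Rightarrow> ('a \<Rightarrow> complex) \<Rightarrow> bool" where
  "lin_indep_on S f h \<longleftrightarrow>
     (\<forall>a b. (\<forall>x\<in>S. a * f x + b * h x = 0) \<longrightarrow> a = 0 \<and> b = 0)"

(* The three-term recurrence solved for its leading term, with the index shifted by one:
   q_poly_shift q nu m stands for P_(m-1).  The defining relations of (P_n) are recovered in
   q_poly_minus_one, q_poly_zero and q_poly_recurrence below. *)
fun q_poly_shift :: "real \<Rightarrow> real \<Rightarrow> nat \<Rightarrow> complex poly" where
  "q_poly_shift q \<nu> 0 = 0"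
| "q_poly_shift q \<nu> (Suc 0) = 1"
| "q_poly_shift q \<nu> (Suc (Suc n)) =
     smult (of_real (inverse (q powr (2 * real n + \<nu> + 1))))
       ([:0, 1:] * q_poly_shift q \<nu> (Suc n)
        + smult (of_real (q powr (2 * real n) * (1 + q powr (2 * \<nu>)))) (q_poly_shift q \<nu> (Suc n))
        - smult (of_real (q powr (2 * real n + \<nu> - 1))) (q_poly_shift q \<nu> n))"

definition q_poly :: "real \<Rightarrow> real \<Rightarrow> int \<Rightarrow> complex poly" where
  "q_poly q \<nu> n = q_poly_shift q \<nu> (nat (n + 1))"

lemma q_poly_minus_one: "q_poly q \<nu> (-1) = 0"
  by (simp add: q_poly_def)

lemma q_poly_zero: "q_poly q \<nu> 0 = 1"
  by (simp add: q_poly_def)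

lemma q_poly_recurrence:
  fixes q \<nu> :: real and n :: int and lam :: complex
  assumes "0 < q" and "0 \<le> n"
  shows "of_real (q powr (2 * n + \<nu> + 1)) * poly (q_poly q \<nu> (n + 1)) lam
         - of_real (q powr (2 * n) * (1 + q powr (2 * \<nu>))) * poly (q_poly q \<nu> n) lam
         + of_real (q powr (2 * n + \<nu> - 1)) * poly (q_poly q \<nu> (n - 1)) lam
         = lam * poly (q_poly q \<nu> n) lam"
proof -
  obtain k where k: "n = int k"
    using assms(2) nonneg_int_cases by blast
  have "nat (n + 1 + 1) = Suc (Suc k)" "nat (n + 1) = Suc k" "nat (n - 1 + 1) = k"
    using k by auto
  moreover have "complex_of_real (q powr (2 * real k + \<nu> + 1)) \<noteq> 0"
    using assms(1) by simp
  moreover have "c * (inverse c * (u + v - w)) - v + w = u" if "c \<noteq> 0" for c u v w :: complex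
    using that by (simp add: mult.assoc [symmetric])
  ultimately show ?thesis
    by (simp add: q_poly_def k del: of_real_add of_real_mult powr_eq_0_iff of_real_eq_0_iff)
qed

end

theory Submission imports Defs begin

text \<open>
  On the lattice of integer powers of \<open>q\<close> the equation \<open>\<Delta>\<^sub>q\<^sub>,\<^sub>\<nu> y = \<lambda> y\<close> is a three-term
  recurrence in the exponent whose outer coefficients do not vanish, so a solution is determined by
  its values at two neighbouring points.

  If \<open>y\<close> solves it, then \<open>q\<^bsup>-n(\<nu>+1)\<^esup> y(q\<^bsup>-n\<^esup>)\<close> satisfies the recurrence of the polynomials
  \<open>P\<^sub>n(\<lambda>)\<close>: the factor \<open>q\<^bsup>-n(\<nu>+1)\<^esup>\<close> turns the coefficients \<open>1\<close> and \<open>q\<^bsup>2\<nu>\<^esup>\<close> of the operator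
  into \<open>q\<^bsup>\<nu>+1\<^esup>\<close> and \<open>q\<^bsup>\<nu>-1\<^esup>\<close>.  The starting value \<open>P\<^sub>-\<^sub>1 = 0\<close> corresponds to \<open>y(q) = 0\<close>, so every
  solution vanishing at \<open>q\<close> is \<open>y(1)\<close> times the \<open>P\<^sub>n(\<lambda>)\<close>, up to that factor
  (\<open>solution_vanishing_at_q\<close>).  The combination \<open>y = h(q) f - f(q) h\<close> is such a solution, and
  \<open>y(1)\<close> is the denominator in the theorem.  This denominator is a Casorati determinant; it is
  nonzero because otherwise some nontrivial combination of \<open>f\<close> and \<open>h\<close> would vanish at both \<open>1\<close>
  and \<open>q\<close>, hence everywhere (\<open>Casoratian_nonzero\<close>).
\<close>

lemma q_Bessel_solution_linear_combination:
  assumes "q_Bessel_solution q \<nu> lam f" "q_Bessel_solution q \<nu> lam h"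
  shows "q_Bessel_solution q \<nu> lam (\<lambda>x. a * f x + b * h x)"
proof -
  have "q_Bessel q \<nu> (\<lambda>x. a * f x + b * h x) x = a * q_Bessel q \<nu> f x + b * q_Bessel q \<nu> h x" for x
    by (simp add: q_Bessel_def algebra_simps add_divide_distrib diff_divide_distrib)
  with assms show ?thesis
    by (simp add: q_Bessel_solution_def algebra_simps)
qed

lemma q_Bessel_solution_three_term:
  assumes "0 < q" "q_Bessel_solution q \<nu> lam y"
  shows "y (q powi (k - 1)) =
    (1 + of_real (q powr (2 * \<nu>)) + lam * of_real ((q powi k)\<^sup>2)) * y (q powi k)
    - of_real (q powr (2 * \<nu>)) * y (q powi (k + 1))"
proof -
  have "inverse q * q powi k = q powi (k - 1)" "q * q powi k = q powi (k + 1)"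
    using assms(1) by (simp_all add: power_int_diff power_int_add field_simps)
  moreover have "q_Bessel q \<nu> y (q powi k) = lam * y (q powi k)"
    using assms(2) by (auto simp: q_Bessel_solution_def Rq_plus_def)
  moreover have "complex_of_real ((q powi k)\<^sup>2) \<noteq> 0"
    using assms(1) by simp
  ultimately have "y (q powi (k - 1)) - of_real (1 + q powr (2 * \<nu>)) * y (q powi k)
      + of_real (q powr (2 * \<nu>)) * y (q powi (k + 1))
      = of_real ((q powi k)\<^sup>2) * (lam * y (q powi k))"
    unfolding q_Bessel_def by (simp add: field_simps del: of_real_power)
  then show ?thesis
    by (simp add: algebra_simps)
qed

text \<open>The recurrence can be run in both directions, since both of its outer coefficients are
  nonzero.\<close>

lemma q_Bessel_solution_eq_zero:
  assumes "0 < q" "q_Bessel_solution q \<nu> lam y" "y 1 = 0" "y q = 0" "x \<in> Rq_plus q"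
  shows "y x = 0"
proof -
  have rec: "y (q powi (k - 1)) =
    (1 + of_real (q powr (2 * \<nu>)) + lam * of_real ((q powi k)\<^sup>2)) * y (q powi k)
    - of_real (q powr (2 * \<nu>)) * y (q powi (k + 1))" for k
    using q_Bessel_solution_three_term assms(1,2) .
  have "y (q powi k) = 0 \<and> y (q powi (k + 1)) = 0" for k
  proof (induction k rule: int_induct[where k = 0])
    case base
    then show ?case using assms by simp
  next
    case (step1 k)
    then show ?case using rec[of "k + 1"] assms(1) by simp
  next
    case (step2 k)
    then show ?case using rec[of k] by simp
  qed
  with assms(5) show ?thesis by (auto simp: Rq_plus_def)
qed

lemma Casoratian_nonzero:
  assumes "0 < q" "q_Bessel_solution q \<nu> lam f" "q_Bessel_solution q \<nu> lam h"
    and indep: "lin_indep_on (Rq_plus q) f h"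
  shows "f 1 * h q - h 1 * f q \<noteq> 0"
proof
  have trivial: "a = 0 \<and> b = 0"
    if "a * f 1 + b * h 1 = 0" "a * f q + b * h q = 0" for a b
  proof -
    have "\<forall>x\<in>Rq_plus q. a * f x + b * h x = 0"
      using q_Bessel_solution_eq_zero
        [OF assms(1) q_Bessel_solution_linear_combination[OF assms(2,3), of a b]] that
      by blast
    with indep show ?thesis unfolding lin_indep_on_def by blast
  qed
  assume W: "f 1 * h q - h 1 * f q = 0"
  \<comment> \<open>The values at \<open>q\<close> are coefficients of a combination vanishing at \<open>1\<close> and \<open>q\<close>, so they are
    zero; then every combination vanishes at \<open>q\<close>, and the values at \<open>1\<close> can be used likewise.\<close>
  have "h q = 0 \<and> f q = 0"
    using trivial[of "h q" "- f q"] W by (simp add: algebra_simps)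
  moreover from this have "h 1 = 0 \<and> f 1 = 0"
    using trivial[of "h 1" "- f 1"] by simp
  ultimately show False
    using trivial[of 1 1] by simp
qed

text \<open>The induction runs over the shifted index \<open>m = n + 1\<close>, so that its base cases are
  \<open>P\<^sub>-\<^sub>1 = 0\<close>, matched by \<open>y q = 0\<close>, and \<open>P\<^sub>0 = 1\<close>.\<close>

lemma solution_vanishing_at_q:
  assumes "0 < q" "q_Bessel_solution q \<nu> lam y" "y q = 0"
  shows "poly (q_poly_shift q \<nu> m) lam * y 1 =
    of_real (q powr (- (real m - 1) * (\<nu> + 1))) * y (q powi (1 - int m))"
proof (induction m rule: induct_nat_012)
  case 0
  then show ?case using assms by simp
next
  case 1
  then show ?case using assms by simp
next
  case (ge2 n)
  \<comment> \<open>\<open>c\<close> is the target factor for \<open>n + 1\<close>; after division by the leading coefficient of the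
    polynomial recurrence, each of its terms is \<open>c\<close> times one of the solution's recurrence at
    \<open>q\<^bsup>-n\<^esup>\<close>, where \<open>r\<close> is the squared argument that multiplies \<open>\<lambda>\<close>.\<close>
  define c where "c = q powr (- (real n + 1) * (\<nu> + 1))"
  define A where "A = q powr (2 * \<nu>)"
  define r where "r = (q powi (- int n))\<^sup>2"
  have r: "r = q powr (- 2 * real n)"
    using assms(1) powr_powr[of q "- real n" 2]
    by (simp add: r_def powr_minus powr_realpow power_int_minus mult.commute)
  have e1: "inverse (q powr (2 * real n + \<nu> + 1)) * q powr (- real n * (\<nu> + 1)) = c * r"
    unfolding c_def r powr_minus[symmetric] powr_add[symmetric] by (simp add: algebra_simps)
  have e2: "q powr (2 * real n) * r = 1"
    using assms(1) unfolding r powr_add[symmetric] by simp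
  have e3: "inverse (q powr (2 * real n + \<nu> + 1)) * q powr (2 * real n + \<nu> - 1)
      * q powr (- (real n - 1) * (\<nu> + 1)) = c * A"
    unfolding c_def A_def powr_minus[symmetric] powr_add[symmetric] by (simp add: algebra_simps)
  define P where "P = poly (q_poly_shift q \<nu> (Suc n)) lam"
  define Q where "Q = poly (q_poly_shift q \<nu> n) lam"
  define i where "i = inverse (q powr (2 * real n + \<nu> + 1))"
  define s where "s = q powr (2 * real n)"
  define t where "t = q powr (2 * real n + \<nu> - 1)"
  define p1 where "p1 = q powr (- real n * (\<nu> + 1))"
  define p0 where "p0 = q powr (- (real n - 1) * (\<nu> + 1))"
  note e = e1[folded i_def p1_def] e2[folded s_def] e3[folded i_def t_def p0_def]
  have P: "P * y 1 = of_real p1 * y (q powi (- int n))"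
    using ge2(2) by (simp add: P_def p1_def)
  have Q: "Q * y 1 = of_real p0 * y (q powi (1 - int n))"
    using ge2(1) by (simp add: Q_def p0_def)
  have "poly (q_poly_shift q \<nu> (Suc (Suc n))) lam * y 1
      = of_real i * ((lam + of_real (s * (1 + A))) * (P * y 1) - of_real t * (Q * y 1))"
    by (simp add: P_def Q_def i_def s_def t_def A_def algebra_simps)
  also have "\<dots> = of_real (i * p1) * (lam + of_real (s * (1 + A))) * y (q powi (- int n))
      - of_real (i * t * p0) * y (q powi (1 - int n))"
    unfolding P Q by (simp add: algebra_simps)
  also have "\<dots> = of_real c * ((of_real (s * r) * (1 + of_real A) + lam * of_real r)
      * y (q powi (- int n)) - of_real A * y (q powi (1 - int n)))"
    unfolding e(1,3) by (simp add: algebra_simps)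
  also have "\<dots> = of_real c * y (q powi (- int n - 1))"
    using q_Bessel_solution_three_term[OF assms(1,2), of "- int n"]
    unfolding e(2) A_def[symmetric] r_def[symmetric] by (simp add: add.commute)
  finally have "poly (q_poly_shift q \<nu> (Suc (Suc n))) lam * y 1
      = of_real c * y (q powi (- int n - 1))" .
  moreover have "- (real (Suc (Suc n)) - 1) = - (real n + 1)" "1 - int (Suc (Suc n)) = - int n - 1"
    by simp_all
  ultimately show ?case
    by (simp only: c_def)
qed

theorem proposition7:
  fixes q \<nu> :: real and lam :: complex and f h :: "real \<Rightarrow> complex"
  assumes "0 < q" and "q < 1"
    and "\<nu> > -1" and "\<nu> \<notin> \<nat>"
    and "q_Bessel_solution q \<nu> lam f"
    and "q_Bessel_solution q \<nu> lam h"
    and "lin_indep_on (Rq_plus q) f h"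
  shows "\<forall>n::int. n \<ge> 0 \<longrightarrow>
    poly (q_poly q \<nu> n) lam =
      of_real (q powr (- real_of_int n * (\<nu> + 1))) *
        ((f (q powi (-n)) * h q - h (q powi (-n)) * f q) / (f 1 * h q - h 1 * f q))"
proof (intro allI impI)
  fix n :: int
  assume n: "n \<ge> 0"
  define y where "y x = h q * f x + (- f q) * h x" for x
  have y: "q_Bessel_solution q \<nu> lam y" "y q = 0"
    using q_Bessel_solution_linear_combination[OF assms(5,6), of "h q" "- f q"]
    by (simp_all add: y_def[abs_def])
  have W: "y 1 \<noteq> 0"
    using Casoratian_nonzero[OF assms(1,5,6,7)] by (simp add: y_def algebra_simps)
  have "real (nat (n + 1)) - 1 = real_of_int n" "1 - int (nat (n + 1)) = - n"
    using n by simp_all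
  then have "poly (q_poly q \<nu> n) lam * y 1
      = of_real (q powr (- real_of_int n * (\<nu> + 1))) * y (q powi (- n))"
    using solution_vanishing_at_q[OF assms(1) y, of "nat (n + 1)"] by (simp only: q_poly_def)
  then have "poly (q_poly q \<nu> n) lam
      = of_real (q powr (- real_of_int n * (\<nu> + 1))) * (y (q powi (- n)) / y 1)"
    using W by (simp add: field_simps)
  moreover have "y x = f x * h q - h x * f q" for x
    by (simp add: y_def algebra_simps)
  ultimately show "poly (q_poly q \<nu> n) lam =
      of_real (q powr (- real_of_int n * (\<nu> + 1))) *
        ((f (q powi (-n)) * h q - h (q powi (-n)) * f q) / (f 1 * h q - h 1 * f q))"
    by (simp only:)
qed

end
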